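(* Let $\mu>0$ and $a>0$ be constants, let $n\geq2$ be an integer, and let $1\leq p<n$. Define $\bar{\mathbf{u}}:(0,\infty)\times\mathbb{R}^n\to\mathbb{R}^n$ by $$\bar{\mathbf{u}}(t,\mathbf{x})=\bar u(t,|\mathbf{x}|)\frac{\mathbf{x}}{|\mathbf{x}|}\ \ (t>0,\ \mathbf{x}\neq\mathbf{0}),\qquad \bar{\mathbf{u}}(t,\mathbf{0})=\mathbf{0}\ \ (t>0),$$ where $$\bar u(t,r)=\frac{r}{t\left[1+a(4\pi\mu t)^{n/2}\exp\left(\frac{r^2}{4\mu t}\right)\right]}.$$ Then $\bar{\mathbf{u}}(t)\to\mathbf{0}$ in $L^p(\mathbb{R}^n)$ as $t\to0+$.
   Context: Here $\bar{\mathbf{u}}(t)$ denotes the function $\mathbf{x}\mapsto\bar{\mathbf{u}}(t,\mathbf{x})$, and the $L^p$ norm is $\|\bar{\mathbf{u}}(t)\|_p=\left(\int_{\mathbb{R}^n}|\bar{\mathbf{u}}(t,\mathbf{x})|^p\,d\mathbf{x}\right)^{1/p}$ with $|\cdot|$ the Euclidean norm. *)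

theory Defs
  imports "HOL-Analysis.Analysis"
begin

definition in_Lp :: "'a measure \<Rightarrow> real \<Rightarrow> ('a \<Rightarrow> 'b::euclidean_space) \<Rightarrow> bool" where
  "in_Lp M p f \<longleftrightarrow> f \<in> borel_measurable M \<and> integrable M (\<lambda>x. norm (f x) powr p)"

text \<open>Meaningful only for functions satisfying \<^const>\<open>in_Lp\<close>: the Bochner integral
  of a non-integrable function is 0.\<close>

definition Lp_norm :: "'a measure \<Rightarrow> real \<Rightarrow> ('a \<Rightarrow> 'b::euclidean_space) \<Rightarrow> real" where
  "Lp_norm M p f = (integral\<^sup>L M (\<lambda>x. norm (f x) powr p)) powr (1 / p)"

definition tendsto_in_Lp ::
    "'a measure \<Rightarrow> real \<Rightarrow> ('t \<Rightarrow> 'a \<Rightarrow> 'b::euclidean_space) \<Rightarrow> ('a \<Rightarrow> 'b) \<Rightarrow> 't filter \<Rightarrow> bool" where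
  "tendsto_in_Lp M p f g F \<longleftrightarrow>
     (\<forall>\<^sub>F t in F. in_Lp M p (f t)) \<and> in_Lp M p g \<and>
     ((\<lambda>t. Lp_norm M p (\<lambda>x. f t x - g x)) \<longlongrightarrow> 0) F"

definition ubar_radial :: "nat \<Rightarrow> real \<Rightarrow> real \<Rightarrow> real \<Rightarrow> real \<Rightarrow> real" where
  "ubar_radial n \<mu> a t r =
     r / (t * (1 + a * (4 * pi * \<mu> * t) powr (real n / 2) * exp (r\<^sup>2 / (4 * \<mu> * t))))"

text \<open>Used only for \<open>t > 0\<close>; the values at \<open>t \<le> 0\<close> are irrelevant.\<close>

definition ubar :: "real \<Rightarrow> real \<Rightarrow> real \<Rightarrow> real ^ 'n \<Rightarrow> real ^ 'n" where
  "ubar \<mu> a t x =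
     (if x = 0 then 0 else ubar_radial CARD('n) \<mu> a t (norm x) *\<^sub>R (x /\<^sub>R norm x))"

end

theory Submission
  imports Defs "HOL-Probability.Distributions"
begin

text \<open>
  Write \<open>n\<close> for the dimension, \<open>r = \<bar>x\<bar>\<close>, \<open>s = r\<^sup>2 / (4 \<mu> t)\<close> and \<open>c = a (4 \<pi> \<mu> t)\<^bsup>n/2\<^esup>\<close>, so
  that \<open>\<bar>u(t, x)\<bar> = (r / t) / (1 + c e\<^sup>s)\<close>. The two obvious bounds of the denominator are each
  useless alone: bounding it below by \<open>1\<close> leaves a function that is not integrable, and bounding
  it below by \<open>c e\<^sup>s\<close> costs a factor \<open>t\<^bsup>-n/2\<^esup>\<close>, more than the
  shrinking Gaussian can compensate. The proof interpolates between
  them: \<open>1 + c e\<^sup>s \<ge> (c e\<^sup>s)\<^bsup>\<theta>\<^esup>\<close> for every \<open>\<theta> \<in> [0, 1]\<close>. Any \<open>\<theta> > 0\<close> keeps a Gaussian decay in \<open>x\<close>,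
  half of which absorbs the factor \<open>r\<close>; this gives
  \<open>\<bar>u(t, x)\<bar> \<le> B t\<^bsup>-1/2 - n\<theta>/2\<^esup> exp (- \<theta> s / 2)\<close> (\<open>norm_ubar_le\<close>).
  The integral of the \<open>p\<close>-th power of the right-hand side is a Gaussian integral
  (\<open>has_bochner_integral_gaussian\<close>), which contributes \<open>t\<^bsup>n/2\<^esup>\<close>. Hence the \<open>p\<close>-th power
  of the norm is at most a constant times \<open>t\<^bsup>(n - p - n\<theta>p)/2\<^esup>\<close>. Since \<open>p < n\<close>, a small \<open>\<theta>\<close>
  makes this exponent positive; \<open>\<theta> = (n - p) / (2 n p)\<close> makes it \<open>(n - p) / 4\<close>.
\<close>

lemma nn_integral_gaussian_real:
  fixes k :: real
  assumes "k > 0"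
  shows "(\<integral>\<^sup>+x. ennreal (exp (- k * x\<^sup>2)) \<partial>lborel) = ennreal (sqrt (pi / k))"
proof -
  let ?\<sigma> = "1 / sqrt (2 * k)"
  have eq: "exp (- k * x\<^sup>2) = sqrt (pi / k) * normal_density 0 ?\<sigma> x" for x
    using assms by (simp add: normal_density_def power_divide)
  have "has_bochner_integral lborel (\<lambda>x. sqrt (pi / k) * normal_density 0 ?\<sigma> x) (sqrt (pi / k) * 1)"
    using assms by (intro has_bochner_integral_mult_right)
      (simp add: has_bochner_integral_iff)
  then have "has_bochner_integral lborel (\<lambda>x. exp (- k * x\<^sup>2)) (sqrt (pi / k))"
    by (simp only: eq mult_1_right)
  then show ?thesis
    by (simp add: has_bochner_integral_iff nn_integral_eq_integral)
qed

text \<open>The integrand factorises over the coordinates because \<open>\<bar>x\<bar>\<^sup>2\<close> is the sum of their squares.\<close>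

lemma has_bochner_integral_gaussian:
  fixes k :: real
  assumes "k > 0"
  shows "has_bochner_integral lborel (\<lambda>x::'a::euclidean_space. exp (- k * (norm x)\<^sup>2))
           ((pi / k) powr (real DIM('a) / 2))"
proof (rule has_bochner_integral_nn_integral)
  have prod: "exp (- k * (norm x)\<^sup>2) = (\<Prod>b\<in>Basis. exp (- k * (x \<bullet> b)\<^sup>2))" for x :: 'a
    unfolding power2_norm_eq_inner euclidean_inner[of x x]
    by (simp add: exp_sum[symmetric] sum_distrib_left power2_eq_square)
  have "nn_integral lborel (\<lambda>x::'a. ennreal (exp (- k * (norm x)\<^sup>2)))
      = nn_integral lborel (\<lambda>x::'a. \<Prod>b\<in>Basis. ennreal (exp (- k * (x \<bullet> b)\<^sup>2)))"
    by (simp only: prod) (simp add: prod_ennreal)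
  also have "\<dots> = (\<Prod>b\<in>(Basis::'a set). ennreal (sqrt (pi / k)))"
    by (subst nn_integral_lborel_prod) (use assms in \<open>simp_all only: nn_integral_gaussian_real\<close>, auto)
  also have "\<dots> = ennreal (sqrt (pi / k) ^ DIM('a))"
    using assms by (simp add: ennreal_power)
  also have "sqrt (pi / k) ^ DIM('a) = (pi / k) powr (real DIM('a) / 2)"
    using assms by (simp add: powr_half_sqrt[symmetric] powr_powr powr_realpow[symmetric])
  finally show "nn_integral lborel (\<lambda>x::'a. ennreal (exp (- k * (norm x)\<^sup>2)))
      = ennreal ((pi / k) powr (real DIM('a) / 2))" .
qed simp_all

text \<open>If \<open>y \<ge> 1\<close>, the power \<open>y powr \<theta>\<close> is at most \<open>y\<close>; otherwise it is at most \<open>1\<close>.\<close>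

lemma powr_le_one_plus:
  fixes y \<theta> :: real
  assumes "0 \<le> y" "0 \<le> \<theta>" "\<theta> \<le> 1"
  shows "y powr \<theta> \<le> 1 + y"
proof (cases "y \<ge> 1")
  case True
  then show ?thesis using powr_mono[of \<theta> 1 y] assms by simp
next
  case False
  then show ?thesis using powr_le1[of \<theta> y] assms by simp
qed

lemma sqrt_le_exp:
  fixes s \<theta> :: real
  assumes "\<theta> > 0"
  shows "sqrt s \<le> exp (\<theta> * s / 2) / sqrt \<theta>"
proof -
  have "\<theta> * s \<le> exp (\<theta> * s)"
    using exp_ge_add_one_self[of "\<theta> * s"] by linarith
  then have "sqrt (\<theta> * s) \<le> sqrt (exp (\<theta> * s))"
    by (rule real_sqrt_le_mono)
  also have "sqrt (exp (\<theta> * s)) = exp (\<theta> * s / 2)"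
    by (rule real_sqrt_unique) (simp_all add: power2_eq_square exp_add[symmetric])
  finally show ?thesis
    using assms by (simp add: real_sqrt_mult field_simps)
qed

lemma norm_ubar:
  fixes x :: "real ^ 'n"
  assumes "t > 0" "a > 0"
  shows "norm (ubar \<mu> a t x) = ubar_radial CARD('n) \<mu> a t (norm x)"
  using assms by (auto simp: ubar_def ubar_radial_def intro!: abs_of_nonneg divide_nonneg_nonneg mult_nonneg_nonneg)

text \<open>The pointwise Gaussian bound obtained by interpolating the denominator with exponent \<open>\<theta>\<close>.
  Half of the decay \<open>exp (- \<theta> s)\<close> pays for the factor \<open>norm x\<close>, by \<open>sqrt_le_exp\<close>.\<close>

lemma norm_ubar_le:
  fixes x :: "real ^ 'n"
  assumes \<mu>: "\<mu> > 0" and a: "a > 0" and t: "t > 0" and \<theta>: "0 < \<theta>" "\<theta> \<le> 1"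
  defines "B \<equiv> sqrt (4 * \<mu> / \<theta>) * (a * (4 * pi * \<mu>) powr (real CARD('n) / 2)) powr - \<theta>"
  shows "norm (ubar \<mu> a t x)
    \<le> B * t powr (- 1 / 2 - real CARD('n) * \<theta> / 2) * exp (- (\<theta> / (8 * \<mu> * t)) * (norm x)\<^sup>2)"
proof -
  define n where "n = real CARD('n)"
  define r where "r = norm x"
  define s where "s = r\<^sup>2 / (4 * \<mu> * t)"
  define c where "c = a * (4 * pi * \<mu> * t) powr (n / 2)"
  have r0: "r \<ge> 0" and s0: "s \<ge> 0" and c0: "c > 0"
    using \<mu> a t by (auto simp: r_def s_def c_def)
  have "r = sqrt (4 * \<mu> * t * s)"
    using \<mu> t r0 by (simp add: s_def)
  also have "\<dots> = sqrt (4 * \<mu> * t) * sqrt s"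
    by (rule real_sqrt_mult)
  also have "\<dots> \<le> sqrt (4 * \<mu> * t) * (exp (\<theta> * s / 2) / sqrt \<theta>)"
    using \<mu> t \<theta> by (intro mult_left_mono sqrt_le_exp) auto
  also have "\<dots> = sqrt (4 * \<mu> / \<theta>) * sqrt t * exp (\<theta> * s / 2)"
    by (simp add: real_sqrt_mult real_sqrt_divide)
  finally have r_le: "r \<le> sqrt (4 * \<mu> / \<theta>) * sqrt t * exp (\<theta> * s / 2)" .
  have den: "c powr \<theta> * exp (\<theta> * s) \<le> 1 + c * exp s"
    using powr_le_one_plus[of "c * exp s" \<theta>] c0 \<theta>
    by (simp add: powr_mult exp_powr_real mult.commute)
  have "norm (ubar \<mu> a t x) = r / (t * (1 + c * exp s))"
    using norm_ubar[OF t a] by (simp add: ubar_radial_def r_def c_def s_def n_def)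
  also have "\<dots> \<le> (sqrt (4 * \<mu> / \<theta>) * sqrt t * exp (\<theta> * s / 2)) / (t * (c powr \<theta> * exp (\<theta> * s)))"
    using den r_le r0 c0 t by (intro frac_le mult_left_mono mult_pos_pos) auto
  also have "\<dots> = sqrt (4 * \<mu> / \<theta>) * c powr - \<theta> * (sqrt t / t) * (exp (\<theta> * s / 2) / exp (\<theta> * s))"
    by (simp add: powr_minus field_simps)
  also have "exp (\<theta> * s / 2) / exp (\<theta> * s) = exp (- (\<theta> / (8 * \<mu> * t)) * r\<^sup>2)"
    by (simp add: exp_diff[symmetric] s_def)
  also have "sqrt t / t = t powr (- 1 / 2)"
    using t by (simp add: powr_half_sqrt[symmetric] powr_minus_divide real_div_sqrt field_simps
        powr_add[symmetric])
  also have "c powr - \<theta> = (a * (4 * pi * \<mu>) powr (n / 2)) powr - \<theta> * t powr (- n * \<theta> / 2)"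
    using \<mu> a t by (simp add: c_def powr_mult powr_powr)
  also have "sqrt (4 * \<mu> / \<theta>) * ((a * (4 * pi * \<mu>) powr (n / 2)) powr - \<theta> * t powr (- n * \<theta> / 2))
      * t powr (- 1 / 2) = B * (t powr (- n * \<theta> / 2) * t powr (- 1 / 2))"
    by (simp add: B_def n_def)
  also have "t powr (- n * \<theta> / 2) * t powr (- 1 / 2) = t powr (- 1 / 2 - n * \<theta> / 2)"
    by (simp add: powr_add[symmetric] algebra_simps)
  finally show ?thesis by (simp add: n_def r_def)
qed

lemma borel_measurable_ubar: "(ubar \<mu> a t :: real ^ 'n \<Rightarrow> real ^ 'n) \<in> borel_measurable borel"
  unfolding ubar_def[abs_def] ubar_radial_def by measurable

text \<open>The pointwise bound is integrated with the interpolation exponent that gives away exactly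
  half of the gap \<open>n - p\<close>: the powers of \<open>t\<close> are \<open>-p/2 - n\<theta>p/2\<close> from the prefactor and
  \<open>n/2\<close> from the Gaussian integral.\<close>

lemma ubar_Lp_bound:
  fixes \<mu> a p :: real
  assumes \<mu>: "\<mu> > 0" and a: "a > 0" and p: "1 \<le> p" "p < real CARD('n::finite)"
  obtains K where
    "\<And>t. t > 0 \<Longrightarrow> integrable lborel (\<lambda>x::real ^ 'n. norm (ubar \<mu> a t x) powr p)"
    and "\<And>t. t > 0 \<Longrightarrow> (LINT x::real ^ 'n|lborel. norm (ubar \<mu> a t x) powr p)
           \<le> K * t powr ((real CARD('n) - p) / 4)"
proof -
  define n where "n = real CARD('n)"
  define \<theta> where "\<theta> = (n - p) / (2 * n * p)"
  have n: "n > p" using p by (simp add: n_def)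
  have "n * 1 \<le> n * p"
    using p n by (intro mult_left_mono) auto
  then have "n - p \<le> 2 * n * p"
    using p n by linarith
  then have \<theta>: "0 < \<theta>" "\<theta> \<le> 1"
    using p n by (auto simp: \<theta>_def)
  define B where "B = sqrt (4 * \<mu> / \<theta>) * (a * (4 * pi * \<mu>) powr (n / 2)) powr - \<theta>"
  have B: "B \<ge> 0" using \<mu> \<theta> by (simp add: B_def)
  define K where "K = B powr p * (8 * pi * \<mu> / (\<theta> * p)) powr (n / 2)"
  have *: "integrable lborel (\<lambda>x::real ^ 'n. norm (ubar \<mu> a t x) powr p)
      \<and> (LINT x::real ^ 'n|lborel. norm (ubar \<mu> a t x) powr p) \<le> K * t powr ((n - p) / 4)"
    if t: "t > 0" for t
  proof -
    define k where "k = \<theta> * p / (8 * \<mu> * t)"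
    define e where "e = - p / 2 - n * \<theta> * p / 2"
    have k: "k > 0" using \<theta> p \<mu> t by (simp add: k_def)
    have le: "norm (ubar \<mu> a t x) powr p \<le> B powr p * t powr e * exp (- k * (norm x)\<^sup>2)"
      for x :: "real ^ 'n"
    proof -
      have "norm (ubar \<mu> a t x) powr p
        \<le> (B * t powr (- 1 / 2 - n * \<theta> / 2) * exp (- (\<theta> / (8 * \<mu> * t)) * (norm x)\<^sup>2)) powr p"
        unfolding B_def n_def using p by (intro powr_mono2 norm_ubar_le \<mu> a t \<theta>) auto
      also have "\<dots> = B powr p * t powr e * exp (- k * (norm x)\<^sup>2)"
        using B by (simp add: powr_mult powr_powr exp_powr_real e_def k_def algebra_simps)
      finally show ?thesis .
    qed
    have gauss: "has_bochner_integral lborel (\<lambda>x::real ^ 'n. B powr p * t powr e * exp (- k * (norm x)\<^sup>2))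
        (B powr p * t powr e * (pi / k) powr (n / 2))"
      using has_bochner_integral_gaussian[OF k, where ?'a = "real ^ 'n"]
      by (intro has_bochner_integral_mult_right) (simp add: n_def)
    have int: "integrable lborel (\<lambda>x::real ^ 'n. norm (ubar \<mu> a t x) powr p)"
    proof (rule Bochner_Integration.integrable_bound)
      show "integrable lborel (\<lambda>x::real ^ 'n. B powr p * t powr e * exp (- k * (norm x)\<^sup>2))"
        using gauss by (rule integrable.intros)
      show "(\<lambda>x::real ^ 'n. norm (ubar \<mu> a t x) powr p) \<in> borel_measurable lborel"
        using borel_measurable_ubar by measurable
      show "AE x::real ^ 'n in lborel. norm (norm (ubar \<mu> a t x) powr p)
          \<le> norm (B powr p * t powr e * exp (- k * (norm x)\<^sup>2))"
        using le by (simp add: abs_mult)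
    qed
    have "(LINT x::real ^ 'n|lborel. norm (ubar \<mu> a t x) powr p)
        \<le> B powr p * t powr e * (pi / k) powr (n / 2)"
      using integral_mono[OF int integrable.intros[OF gauss] le]
      by (simp only: has_bochner_integral_integral_eq[OF gauss])
    also have "(pi / k) powr (n / 2) = (8 * pi * \<mu> / (\<theta> * p) * t) powr (n / 2)"
      by (simp add: k_def field_simps)
    also have "\<dots> = (8 * pi * \<mu> / (\<theta> * p)) powr (n / 2) * t powr (n / 2)"
      using \<mu> \<theta> p t by (intro powr_mult)
    also have "B powr p * t powr e * \<dots> = K * (t powr e * t powr (n / 2))"
      by (simp add: K_def)
    also have "t powr e * t powr (n / 2) = t powr ((n - p) / 4)"
    proof -
      have "n * \<theta> * p = (n - p) / 2"
        using n p by (simp add: \<theta>_def)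
      then have "e + n / 2 = (n - p) / 4"
        by (simp only: e_def) (simp add: field_simps)
      then show ?thesis
        by (simp only: powr_add[symmetric])
    qed
    finally show ?thesis using int by simp
  qed
  show thesis
    using * by (intro that[of K]) (auto simp: n_def)
qed

theorem lemma2p3:
  fixes \<mu> a p :: real
  assumes "\<mu> > 0" and "a > 0" and "CARD('n::finite) \<ge> 2"
    and "1 \<le> p" and "p < real CARD('n)"
  shows "(\<forall>t>0. in_Lp lebesgue p (ubar \<mu> a t :: real ^ 'n \<Rightarrow> real ^ 'n)) \<and>
         tendsto_in_Lp lebesgue p (\<lambda>t. (ubar \<mu> a t :: real ^ 'n \<Rightarrow> real ^ 'n)) (\<lambda>x. 0) (at_right 0)"
proof -
  let ?u = "\<lambda>t. ubar \<mu> a t :: real ^ 'n \<Rightarrow> real ^ 'n"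
  let ?I = "\<lambda>t. LINT x|lborel. norm (?u t x) powr p"
  obtain K where int: "\<And>t. t > 0 \<Longrightarrow> integrable lborel (\<lambda>x. norm (?u t x) powr p)"
    and le: "\<And>t. t > 0 \<Longrightarrow> ?I t \<le> K * t powr ((real CARD('n) - p) / 4)"
    using ubar_Lp_bound[OF assms(1,2,4,5)] by metis
  have meas: "(\<lambda>x. norm (?u t x) powr p) \<in> borel_measurable lborel" for t
    using borel_measurable_ubar by measurable
  have Lp: "in_Lp lebesgue p (?u t)" if "t > 0" for t
    unfolding in_Lp_def
  proof
    show "?u t \<in> borel_measurable lebesgue"
      using borel_measurable_ubar by (intro measurable_completion) simp
    show "integrable lebesgue (\<lambda>x. norm (?u t x) powr p)"
      using int[OF that] by (simp only: integrable_completion[OF meas])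
  qed
  have pos: "\<forall>\<^sub>F t::real in at_right 0. t > 0"
    by (simp add: eventually_at_right_less)
  have "((\<lambda>t::real. t powr ((real CARD('n) - p) / 4)) \<longlongrightarrow> 0 powr ((real CARD('n) - p) / 4)) (at_right 0)"
    using assms(5) eventually_mono[OF pos less_imp_le]
    by (intro tendsto_powr' tendsto_const tendsto_ident_at) auto
  from tendsto_mult_left[OF this, of K]
  have "((\<lambda>t::real. K * t powr ((real CARD('n) - p) / 4)) \<longlongrightarrow> 0) (at_right 0)"
    by simp
  then have I0: "(?I \<longlongrightarrow> 0) (at_right 0)"
    by (rule tendsto_sandwich[OF _ _ tendsto_const, rotated 2])
      (auto intro!: always_eventually eventually_mono[OF pos le])
  have "((\<lambda>t. ?I t powr (1 / p)) \<longlongrightarrow> 0 powr (1 / p)) (at_right 0)"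
    using assms(4) by (intro tendsto_powr' I0 tendsto_const) auto
  then have "((\<lambda>t. Lp_norm lebesgue p (\<lambda>x. ?u t x - 0)) \<longlongrightarrow> 0) (at_right 0)"
    by (simp add: Lp_norm_def integral_completion[OF meas])
  moreover have "\<forall>\<^sub>F t in at_right 0. in_Lp lebesgue p (?u t)"
    using pos by (rule eventually_mono) (rule Lp)
  moreover have "in_Lp lebesgue p (\<lambda>x::real ^ 'n. 0 :: real ^ 'n)"
    by (simp add: in_Lp_def)
  ultimately show ?thesis
    using Lp by (simp add: tendsto_in_Lp_def)
qed

end
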